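(* Consider the estimation error dynamics $$\dot e=Ne+MS_a\,\delta g-MD_af^{(r)}$$ described in the context. Suppose there exist matrices $P\in\mathbb{R}^{n_z\times n_z}$ with $P\succ0$, $R,Q\in\mathbb{R}^{n_z\times m}$, $J\in\mathbb{R}^{n_v\times m}$, and a scalar $\rho\ge0$ satisfying $$\begin{bmatrix}L_{11} & (P+RC_a)D_a & X_{12}\\ * & -\rho I & \boldsymbol0\\ * & * & -I\end{bmatrix}\preceq0,\qquad L_{11}:=X+\tfrac12\bar C^T\bar C,$$ where $$ \begin{aligned} X &:= S_{11}+\alpha\,(V_a^TV_a - V_a^TJC_a - C_a^TJ^TV_a),\\ S_{11} &:= A_a^TP + A_a^TC_a^TR^T - C_a^TQ^T + PA_a + RC_aA_a - QC_a,\\ X_{12} &:= \sqrt{\alpha}\,\begin{bmatrix}(P+RC_a)S_a & C_a^TJ^T\end{bmatrix}. \end{aligned} $$ Then, with observer gains $E=P^{-1}R$, $K=P^{-1}Q$ and $J$, the $\mathcal L_2$-gain from $f^{(r)}$ to the fault estimation error $p=\bar Ce$ is upper bounded by $\sqrt{2\rho}$.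
   Context: **System.** $\dot x = Ax+Bu+S\,g(Vx,u)+F_xf$, $y=Cx+F_yf$, with state $x(t)\in\mathbb{R}^n$, output $y(t)\in\mathbb{R}^m$, known input $u(t)\in\mathbb{R}^l$, unknown fault $f:\mathbb{R}^+\to\mathbb{R}^{n_f}$, real matrices $A,B,S,V,C,F_x,F_y$ of sizes $n\times n$, $n\times l$, $n\times n_g$, $n_v\times n$, $m\times n$, $n\times n_f$, $m\times n_f$, and $g:\mathbb{R}^{n_v}\times\mathbb{R}^l\to\mathbb{R}^{n_g}$. **Standing assumptions.** (1) $g(Vx,u)$ is globally Lipschitz uniformly in $u$ and $t$: there is a known constant $\alpha>0$ with $\|g(V\hat x,u)-g(Vx,u)\|\le\alpha\|V(\hat x-x)\|$ for all $x,\hat x\in\mathbb{R}^{n}$, $u\in\mathbb{R}^l$. (2) For a fixed integer $r\ge1$, $f$ is $r$ times differentiable, the derivatives $f^{(1)},\dots,f^{(r)}$ are continuous, and $f^{(r)}$ is uniformly bounded. **Augmented system.** With $x_a:=\mathrm{col}[x,f,\dot f,\dots,f^{(r-1)}]\in\mathbb{R}^{n_z}$, $n_z:=n+rn_f$: $\dot x_a=A_ax_a+B_au+S_ag(V_ax_a,u)+D_af^{(r)}$, $y=C_ax_a$, where $$A_a=\begin{bmatrix}A&F_x&\boldsymbol0&\cdots&\boldsymbol0\\ \boldsymbol0&\boldsymbol0&I_{n_f}&\cdots&\boldsymbol0\\ \vdots&\vdots&\vdots&\ddots&\vdots\\ \boldsymbol0&\boldsymbol0&\boldsymbol0&\cdots&I_{n_f}\\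 \boldsymbol0&\boldsymbol0&\boldsymbol0&\cdots&\boldsymbol0\end{bmatrix},\quad B_a=\begin{bmatrix}B\\ \boldsymbol0\end{bmatrix},\quad S_a=\begin{bmatrix}S\\ \boldsymbol0\end{bmatrix},\quad D_a=\begin{bmatrix}\boldsymbol0\\ I_{n_f}\end{bmatrix},$$ $V_a=[V\ \ \boldsymbol0]$, $C_a=[C\ \ F_y\ \ \boldsymbol0]$ (for $r=1$, $A_a=\begin{bmatrix}A&F_x\\ \boldsymbol0&\boldsymbol0\end{bmatrix}$ and $C_a=[C\ \ F_y]$). Also $\bar C:=[\boldsymbol0_{n_f\times n}\ \ I_{n_f}\ \ \boldsymbol0_{n_f\times n_f(r-1)}]$, so $\bar Cx_a=f$. **Observer.** Given gains $E,K\in\mathbb{R}^{n_z\times m}$, $J\in\mathbb{R}^{n_v\times m}$, set $M:=I+EC_a$, $N:=MA_a-KC_a$, $G:=MB_a$, $L:=K(I+C_aE)-MA_aE$, and $$\dot z=Nz+Gu+Ly+MS_a\,g\big(V_a\hat x_a+J(y-C_a\hat x_a),u\big),\qquad \hat x_a=z-Ey.$$ The estimation error $e:=\hat x_a-x_a$ obeys $\dot e=Ne+MS_a\delta g-MD_af^{(r)}$ with $\delta g:=g(V_a\hat x_a+J(y-C_a\hat x_a),u)-g(V_ax_a,u)$. **$\mathcal L_2$-gain.** The error dynamics with input $f^{(r)}$ and output $\bar Ce$ has $\mathcal L_2$-gain less than or equal to (upper bounded by) $\lambda$ if $\int_0^T\|\bar Ce(t)\|^2dt\le\lambda^2\int_0^T\|f^{(r)}(t)\|^2dt$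 for all $T\ge0$ and all $f^{(r)}\in\mathcal L_2(0,T)$. **Notation.** $\|\cdot\|$ is the Euclidean norm; $\succ0$, $\preceq0$ mean (symmetric) positive definite, negative semidefinite; $*$ denotes blocks determined by symmetry; $\mathcal L_2(0,T)$ is the set of vector-valued functions $h$ on $[0,T]$ with $\int_0^T\|h(t)\|^2dt<\infty$.
   Formalization: The Lipschitz bound on g is required at all points Vx+Jη (where the observer evaluates g), not only on the range of V, since the claim fails otherwise; and the gain inequality is stated for zero initial error e(0)=0, without which it fails for zero input. *)

theory Defs
  imports "HOL-Analysis.Analysis"
begin

definition hblock :: "real^'a^'m \<Rightarrow> real^'b^'m \<Rightarrow> real^('a + 'b)^'m" where
  "hblock X Y = (\<chi> i j. case j of Inl a \<Rightarrow> X $ i $ a | Inr b \<Rightarrow> Y $ i $ b)"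

definition vblock :: "real^'k^'a \<Rightarrow> real^'k^'b \<Rightarrow> real^'k^('a + 'b)" where
  "vblock X Y = (\<chi> i. case i of Inl a \<Rightarrow> X $ a | Inr b \<Rightarrow> Y $ b)"

definition pos_def :: "real^'k^'k \<Rightarrow> bool" where
  "pos_def A \<longleftrightarrow> transpose A = A \<and> (\<forall>x. x \<noteq> 0 \<longrightarrow> 0 < x \<bullet> (A *v x))"

definition neg_semidef :: "real^'k^'k \<Rightarrow> bool" where
  "neg_semidef A \<longleftrightarrow> transpose A = A \<and> (\<forall>x. x \<bullet> (A *v x) \<le> 0)"


text \<open>
  The fault derivatives \<open>f, f', \<dots>, f\<^sup>(\<^sup>r\<^sup>-\<^sup>1\<^sup>)\<close> are indexed by a finite linear order \<open>'r\<close> with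
  \<open>r = CARD('r) \<ge> 1\<close> (\<open>Min UNIV\<close> is the index of \<open>f\<close> itself, \<open>Max UNIV\<close> that of
  \<open>f\<^sup>(\<^sup>r\<^sup>-\<^sup>1\<^sup>)\<close>), and the augmented state by \<open>'n + 'r \<times> 'f\<close>.  The following three matrices are
  \<open>[I 0 \<dots> 0]\<close>, \<open>[0 \<dots> 0 I]\<^sup>T\<close>, and the block matrix with identities on the first
  block superdiagonal.
\<close>

definition fault_first :: "real^('r::{finite,linorder} \<times> 'f::finite)^'f" where
  "fault_first = (\<chi> i j. if fst j = Min UNIV \<and> snd j = i then 1 else 0)"

definition fault_last :: "real^'f::finite^('r::{finite,linorder} \<times> 'f)" where
  "fault_last = (\<chi> i j. if fst i = Max UNIV \<and> snd i = j then 1 else 0)"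

definition fault_shift ::
    "real^('r::{finite,linorder} \<times> 'f::finite)^('r \<times> 'f)" where
  "fault_shift = (\<chi> i j.
     if fst i < fst j \<and> {fst i<..<fst j} = {} \<and> snd i = snd j then 1 else 0)"

definition aug_A ::
    "real^'n^'n \<Rightarrow> real^'f^'n \<Rightarrow>
     real^('n::finite + 'r::{finite,linorder} \<times> 'f::finite)^('n + 'r \<times> 'f)" where
  "aug_A A F\<^sub>x = vblock (hblock A (F\<^sub>x ** fault_first)) (hblock 0 fault_shift)"

definition aug_B ::
    "real^'l^'n \<Rightarrow> real^'l^('n::finite + 'r::{finite,linorder} \<times> 'f::finite)" where
  "aug_B B = vblock B 0"

definition aug_V ::
    "real^'n^'v \<Rightarrow> real^('n::finite + 'r::{finite,linorder} \<times> 'f::finite)^'v" where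
  "aug_V V = hblock V 0"

definition aug_C ::
    "real^'n^'m \<Rightarrow> real^'f^'m \<Rightarrow>
     real^('n::finite + 'r::{finite,linorder} \<times> 'f::finite)^'m" where
  "aug_C C F\<^sub>y = hblock C (F\<^sub>y ** fault_first)"

definition aug_D ::
    "real^'f^('n::finite + 'r::{finite,linorder} \<times> 'f::finite)" where
  "aug_D = vblock 0 fault_last"

definition fault_out ::
    "real^('n::finite + 'r::{finite,linorder} \<times> 'f::finite)^'f" where
  "fault_out = hblock 0 fault_first"


text \<open>
  The observer evaluates \<open>g\<close> at \<open>V\<^sub>a x\<^sub>a' + J (y - C\<^sub>a x\<^sub>a')\<close>, which need not lie in the range of
  \<open>V\<close>.  The Lipschitz bound is therefore required on all sums \<open>V x + J \<eta>\<close>.  For \<open>\<eta> = 0\<close> this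
  is the usual bound \<open>\<parallel>g (V x') u - g (V x) u\<parallel> \<le> \<alpha> \<parallel>V (x' - x)\<parallel>\<close>, and nothing more is
  required when the range of \<open>J\<close> is contained in that of \<open>V\<close>, in particular when \<open>V\<close> has
  full row rank.
\<close>

definition uniformly_lipschitz ::
    "real \<Rightarrow> real^'n^'v \<Rightarrow> real^'m^'v \<Rightarrow> (real^'v \<Rightarrow> real^'l \<Rightarrow> real^'g) \<Rightarrow> bool" where
  "uniformly_lipschitz \<alpha> V J g \<longleftrightarrow>
     (\<forall>u. \<alpha>-lipschitz_on {V *v x + J *v \<eta> | x \<eta>. True} (\<lambda>v. g v u))"

lemma uniformly_lipschitz_iff:
  fixes V :: "real^'n^'v" and J :: "real^'m^'v" and g :: "real^'v \<Rightarrow> real^'l \<Rightarrow> real^'g"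
  assumes "\<alpha> > 0" and "range ((*v) J) \<subseteq> range ((*v) V)"
  shows "uniformly_lipschitz \<alpha> V J g \<longleftrightarrow>
    (\<forall>x x' u. norm (g (V *v x') u - g (V *v x) u) \<le> \<alpha> * norm (V *v (x' - x)))"
proof -
  have "{V *v x + J *v \<eta> | x \<eta>. True} = range ((*v) V)"
  proof (intro equalityI subsetI)
    fix v assume "v \<in> {V *v x + J *v \<eta> | x \<eta>. True}"
    then obtain x \<eta> where v: "v = V *v x + J *v \<eta>" by auto
    obtain x' where "J *v \<eta> = V *v x'" using assms(2) by auto
    then have "v = V *v (x + x')" by (simp add: v matrix_vector_right_distrib)
    then show "v \<in> range ((*v) V)" by auto
  next
    fix v assume "v \<in> range ((*v) V)"
    then obtain x where "v = V *v x + J *v 0" by auto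
    then show "v \<in> {V *v x + J *v \<eta> | x \<eta>. True}" by blast
  qed
  then show ?thesis
    using assms(1)
    by (auto simp: uniformly_lipschitz_def lipschitz_on_def dist_norm
        matrix_vector_mult_diff_distrib)
qed


text \<open>
  Solutions of \<open>x' = h\<close> on \<open>[0, T]\<close> are meant in the integral sense, so that inputs that are
  merely square integrable are allowed; classical solutions are a special case.
\<close>

definition solves_on :: "real \<Rightarrow> (real \<Rightarrow> 'a::euclidean_space) \<Rightarrow> (real \<Rightarrow> 'a) \<Rightarrow> bool" where
  "solves_on T h x \<longleftrightarrow> (\<forall>t\<in>{0..T}. (h has_integral (x t - x 0)) {0..t})"

lemma solves_on_classical:
  assumes "\<And>t. t \<in> {0..T} \<Longrightarrow> (x has_vector_derivative h t) (at t within {0..T})"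
  shows "solves_on T h x"
  unfolding solves_on_def
proof
  fix t assume "t \<in> {0..T}"
  then show "(h has_integral (x t - x 0)) {0..t}"
    by (intro fundamental_theorem_of_calculus
        has_vector_derivative_within_subset [OF assms]) auto
qed

text \<open>
  The input \<open>w\<close> stands for the highest fault derivative \<open>f\<^sup>(\<^sup>r\<^sup>)\<close>.
\<close>

definition plant_rhs ::
    "real^'z^'z \<Rightarrow> real^'l^'z \<Rightarrow> real^'g^'z \<Rightarrow> real^'z^'v \<Rightarrow> real^'f^'z \<Rightarrow>
     (real^'v \<Rightarrow> real^'l \<Rightarrow> real^'g) \<Rightarrow>
     (real \<Rightarrow> real^'l) \<Rightarrow> (real \<Rightarrow> real^'f) \<Rightarrow> (real \<Rightarrow> real^'z) \<Rightarrow> real \<Rightarrow> real^'z" where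
  "plant_rhs A\<^sub>a B\<^sub>a S\<^sub>a V\<^sub>a D\<^sub>a g u w x\<^sub>a t =
     A\<^sub>a *v x\<^sub>a t + B\<^sub>a *v u t + S\<^sub>a *v g (V\<^sub>a *v x\<^sub>a t) (u t) + D\<^sub>a *v w t"

definition obs_M :: "real^'z^'m \<Rightarrow> real^'m^'z \<Rightarrow> real^'z^'z" where
  "obs_M C\<^sub>a E = mat 1 + E ** C\<^sub>a"

definition obs_N :: "real^'z^'z \<Rightarrow> real^'z^'m \<Rightarrow> real^'m^'z \<Rightarrow> real^'m^'z \<Rightarrow> real^'z^'z" where
  "obs_N A\<^sub>a C\<^sub>a E K = obs_M C\<^sub>a E ** A\<^sub>a - K ** C\<^sub>a"

definition obs_L :: "real^'z^'z \<Rightarrow> real^'z^'m \<Rightarrow> real^'m^'z \<Rightarrow> real^'m^'z \<Rightarrow> real^'m^'z" where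
  "obs_L A\<^sub>a C\<^sub>a E K = K ** (mat 1 + C\<^sub>a ** E) - obs_M C\<^sub>a E ** A\<^sub>a ** E"

definition observer_rhs ::
    "real^'z^'z \<Rightarrow> real^'l^'z \<Rightarrow> real^'g^'z \<Rightarrow> real^'z^'v \<Rightarrow> real^'z^'m \<Rightarrow>
     (real^'v \<Rightarrow> real^'l \<Rightarrow> real^'g) \<Rightarrow> real^'m^'z \<Rightarrow> real^'m^'z \<Rightarrow> real^'m^'v \<Rightarrow>
     (real \<Rightarrow> real^'l) \<Rightarrow> (real \<Rightarrow> real^'m) \<Rightarrow> (real \<Rightarrow> real^'z) \<Rightarrow> real \<Rightarrow> real^'z" where
  "observer_rhs A\<^sub>a B\<^sub>a S\<^sub>a V\<^sub>a C\<^sub>a g E K J u y z t =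
     (let xh = z t - E *v y t in
        obs_N A\<^sub>a C\<^sub>a E K *v z t + (obs_M C\<^sub>a E ** B\<^sub>a) *v u t + obs_L A\<^sub>a C\<^sub>a E K *v y t
        + (obs_M C\<^sub>a E ** S\<^sub>a) *v g (V\<^sub>a *v xh + J *v (y t - C\<^sub>a *v xh)) (u t))"

definition delta_g ::
    "real^'z^'v \<Rightarrow> real^'z^'m \<Rightarrow> (real^'v \<Rightarrow> real^'l \<Rightarrow> real^'g) \<Rightarrow> real^'m^'v \<Rightarrow>
     (real \<Rightarrow> real^'l) \<Rightarrow> (real \<Rightarrow> real^'z) \<Rightarrow> (real \<Rightarrow> real^'z) \<Rightarrow> real \<Rightarrow> real^'g" where
  "delta_g V\<^sub>a C\<^sub>a g J u x\<^sub>a e t =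
     (let xh = x\<^sub>a t + e t; y = C\<^sub>a *v x\<^sub>a t in
        g (V\<^sub>a *v xh + J *v (y - C\<^sub>a *v xh)) (u t) - g (V\<^sub>a *v x\<^sub>a t) (u t))"

definition error_rhs ::
    "real^'z^'z \<Rightarrow> real^'g^'z \<Rightarrow> real^'z^'v \<Rightarrow> real^'z^'m \<Rightarrow> real^'f^'z \<Rightarrow>
     (real^'v \<Rightarrow> real^'l \<Rightarrow> real^'g) \<Rightarrow> real^'m^'z \<Rightarrow> real^'m^'z \<Rightarrow> real^'m^'v \<Rightarrow>
     (real \<Rightarrow> real^'l) \<Rightarrow> (real \<Rightarrow> real^'f) \<Rightarrow>
     (real \<Rightarrow> real^'z) \<Rightarrow> (real \<Rightarrow> real^'z) \<Rightarrow> real \<Rightarrow> real^'z" where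
  "error_rhs A\<^sub>a S\<^sub>a V\<^sub>a C\<^sub>a D\<^sub>a g E K J u w x\<^sub>a e t =
     obs_N A\<^sub>a C\<^sub>a E K *v e t + (obs_M C\<^sub>a E ** S\<^sub>a) *v delta_g V\<^sub>a C\<^sub>a g J u x\<^sub>a e t
     - (obs_M C\<^sub>a E ** D\<^sub>a) *v w t"

lemma error_rhs_eq:
  "error_rhs A\<^sub>a S\<^sub>a V\<^sub>a C\<^sub>a D\<^sub>a g E K J u w x\<^sub>a (\<lambda>t. z t - E *v (C\<^sub>a *v x\<^sub>a t) - x\<^sub>a t) t =
     observer_rhs A\<^sub>a B\<^sub>a S\<^sub>a V\<^sub>a C\<^sub>a g E K J u (\<lambda>t. C\<^sub>a *v x\<^sub>a t) z t
     - obs_M C\<^sub>a E *v plant_rhs A\<^sub>a B\<^sub>a S\<^sub>a V\<^sub>a D\<^sub>a g u w x\<^sub>a t"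
  by (simp add: error_rhs_def observer_rhs_def plant_rhs_def delta_g_def Let_def
      obs_N_def obs_L_def matrix_vector_right_distrib matrix_vector_mult_diff_distrib
      matrix_vector_mult_diff_rdistrib matrix_vector_mult_add_rdistrib
      matrix_vector_mul_assoc [symmetric])

text \<open>
  Along a trajectory of the plant with output \<open>y = C\<^sub>a x\<^sub>a\<close>, the observer equation for \<open>z\<close> is
  the same as the error equation for \<open>e = z - E y - x\<^sub>a\<close>.
\<close>

lemma observer_iff_error:
  fixes A\<^sub>a :: "real^'z^'z" and B\<^sub>a :: "real^'l^'z" and S\<^sub>a :: "real^'g^'z"
    and V\<^sub>a :: "real^'z^'v" and C\<^sub>a :: "real^'z^'m" and D\<^sub>a :: "real^'f^'z"
    and E K :: "real^'m^'z" and J :: "real^'m^'v" and x\<^sub>a z :: "real \<Rightarrow> real^'z"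
  assumes "solves_on T (plant_rhs A\<^sub>a B\<^sub>a S\<^sub>a V\<^sub>a D\<^sub>a g u w x\<^sub>a) x\<^sub>a"
  defines "y \<equiv> \<lambda>t. C\<^sub>a *v x\<^sub>a t"
  defines "e \<equiv> \<lambda>t. z t - E *v y t - x\<^sub>a t"
  shows "solves_on T (observer_rhs A\<^sub>a B\<^sub>a S\<^sub>a V\<^sub>a C\<^sub>a g E K J u y z) z \<longleftrightarrow>
         solves_on T (error_rhs A\<^sub>a S\<^sub>a V\<^sub>a C\<^sub>a D\<^sub>a g E K J u w x\<^sub>a e) e"
proof -
  let ?p = "plant_rhs A\<^sub>a B\<^sub>a S\<^sub>a V\<^sub>a D\<^sub>a g u w x\<^sub>a"
  let ?o = "observer_rhs A\<^sub>a B\<^sub>a S\<^sub>a V\<^sub>a C\<^sub>a g E K J u y z"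
  let ?e = "error_rhs A\<^sub>a S\<^sub>a V\<^sub>a C\<^sub>a D\<^sub>a g E K J u w x\<^sub>a e"
  let ?M = "obs_M C\<^sub>a E"
  have rhs: "?e = (\<lambda>t. ?o t - ?M *v ?p t)"
    unfolding y_def e_def by (rule ext) (rule error_rhs_eq)
  have inc: "e t - e 0 = (z t - z 0) - ?M *v (x\<^sub>a t - x\<^sub>a 0)" for t
    by (simp add: e_def y_def obs_M_def matrix_vector_mult_add_rdistrib
        matrix_vector_mult_diff_distrib matrix_vector_mul_assoc [symmetric])
  have "(?o has_integral z t - z 0) {0..t} \<longleftrightarrow> (?e has_integral e t - e 0) {0..t}"
    if t: "t \<in> {0..T}" for t
  proof -
    have "(?p has_integral x\<^sub>a t - x\<^sub>a 0) {0..t}"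
      using assms(1) t by (auto simp: solves_on_def)
    then have Mp: "((\<lambda>s. ?M *v ?p s) has_integral ?M *v (x\<^sub>a t - x\<^sub>a 0)) {0..t}"
      using has_integral_linear [OF _ matrix_vector_mul_bounded_linear [of ?M]]
      unfolding o_def by blast
    show ?thesis
    proof
      assume "(?o has_integral z t - z 0) {0..t}"
      from has_integral_diff [OF this Mp] show "(?e has_integral e t - e 0) {0..t}"
        by (simp add: rhs inc)
    next
      assume "(?e has_integral e t - e 0) {0..t}"
      from has_integral_add [OF this Mp] show "(?o has_integral z t - z 0) {0..t}"
        by (simp add: rhs inc)
    qed
  qed
  then show ?thesis by (auto simp: solves_on_def)
qed


definition L2_on :: "real \<Rightarrow> (real \<Rightarrow> 'a::euclidean_space) \<Rightarrow> bool" where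
  "L2_on T h \<longleftrightarrow> h \<in> borel_measurable (lebesgue_on {0..T}) \<and>
     integrable (lebesgue_on {0..T}) (\<lambda>t. (norm (h t))\<^sup>2)"

text \<open>
  \<open>sys T w p\<close> means that \<open>p\<close> is a possible output on \<open>[0, T]\<close> under the input \<open>w\<close>.
  Membership \<open>L2_on T p\<close> rules out that the left integral is \<open>0\<close> for lack of integrability.
\<close>

definition L2_gain_le ::
    "real \<Rightarrow>
     (real \<Rightarrow> (real \<Rightarrow> 'a::euclidean_space) \<Rightarrow> (real \<Rightarrow> 'b::euclidean_space) \<Rightarrow> bool) \<Rightarrow>
     bool" where
  "L2_gain_le \<gamma> sys \<longleftrightarrow>
     (\<forall>T\<ge>0. \<forall>w p. L2_on T w \<and> sys T w p \<longrightarrow>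
        L2_on T p \<and>
        (\<integral>t. (norm (p t))\<^sup>2 \<partial>lebesgue_on {0..T}) \<le>
          \<gamma>\<^sup>2 * (\<integral>t. (norm (w t))\<^sup>2 \<partial>lebesgue_on {0..T}))"

text \<open>
  As usual for gain inequalities without a bias term, the initial error is zero.  The plant
  trajectory and the known input, on which \<open>\<delta>g\<close> depends, are arbitrary.
\<close>

definition error_dynamics ::
    "real^'z^'z \<Rightarrow> real^'l^'z \<Rightarrow> real^'g^'z \<Rightarrow> real^'z^'v \<Rightarrow> real^'z^'m \<Rightarrow> real^'f^'z \<Rightarrow>
     real^'z^'p \<Rightarrow> (real^'v \<Rightarrow> real^'l \<Rightarrow> real^'g) \<Rightarrow> real^'m^'z \<Rightarrow> real^'m^'z \<Rightarrow> real^'m^'v \<Rightarrow>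
     real \<Rightarrow> (real \<Rightarrow> real^'f) \<Rightarrow> (real \<Rightarrow> real^'p) \<Rightarrow> bool" where
  "error_dynamics A\<^sub>a B\<^sub>a S\<^sub>a V\<^sub>a C\<^sub>a D\<^sub>a Cb g E K J T w p \<longleftrightarrow>
     (\<exists>u x\<^sub>a e.
        solves_on T (plant_rhs A\<^sub>a B\<^sub>a S\<^sub>a V\<^sub>a D\<^sub>a g u w x\<^sub>a) x\<^sub>a \<and>
        solves_on T (error_rhs A\<^sub>a S\<^sub>a V\<^sub>a C\<^sub>a D\<^sub>a g E K J u w x\<^sub>a e) e \<and>
        e 0 = 0 \<and> p = (\<lambda>t. Cb *v e t))"


definition lmi_X ::
    "real \<Rightarrow> real^'z^'z \<Rightarrow> real^'z^'v \<Rightarrow> real^'z^'m \<Rightarrow> real^'z^'z \<Rightarrow> real^'m^'z \<Rightarrow> real^'m^'z \<Rightarrow>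
     real^'m^'v \<Rightarrow> real^'z^'z" where
  "lmi_X \<alpha> A\<^sub>a V\<^sub>a C\<^sub>a P R Q J =
     (transpose A\<^sub>a ** P + transpose A\<^sub>a ** transpose C\<^sub>a ** transpose R
        - transpose C\<^sub>a ** transpose Q + P ** A\<^sub>a + R ** C\<^sub>a ** A\<^sub>a - Q ** C\<^sub>a)
     + \<alpha> *\<^sub>R (transpose V\<^sub>a ** V\<^sub>a - transpose V\<^sub>a ** J ** C\<^sub>a
        - transpose C\<^sub>a ** transpose J ** V\<^sub>a)"

definition lmi_X12 ::
    "real \<Rightarrow> real^'g^'z \<Rightarrow> real^'z^'m \<Rightarrow> real^'z^'z \<Rightarrow> real^'m^'z \<Rightarrow> real^'m^'v \<Rightarrow>
     real^('g + 'v)^'z" where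
  "lmi_X12 \<alpha> S\<^sub>a C\<^sub>a P R J =
     sqrt \<alpha> *\<^sub>R hblock ((P + R ** C\<^sub>a) ** S\<^sub>a) (transpose C\<^sub>a ** transpose J)"

definition lmi_matrix ::
    "real \<Rightarrow> real^'z^'z \<Rightarrow> real^'g^'z \<Rightarrow> real^'z^'v \<Rightarrow> real^'z^'m \<Rightarrow> real^'f^'z \<Rightarrow> real^'z^'p \<Rightarrow>
     real^'z^'z \<Rightarrow> real^'m^'z \<Rightarrow> real^'m^'z \<Rightarrow> real^'m^'v \<Rightarrow> real \<Rightarrow>
     real^('z + ('f + ('g + 'v)))^('z + ('f + ('g + 'v)))" where
  "lmi_matrix \<alpha> A\<^sub>a S\<^sub>a V\<^sub>a C\<^sub>a D\<^sub>a Cb P R Q J \<rho> =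
     (let L11 = lmi_X \<alpha> A\<^sub>a V\<^sub>a C\<^sub>a P R Q J + (1 / 2) *\<^sub>R (transpose Cb ** Cb);
          L12 = (P + R ** C\<^sub>a) ** D\<^sub>a;
          X12 = lmi_X12 \<alpha> S\<^sub>a C\<^sub>a P R J
      in vblock (hblock L11             (hblock L12            X12))
        (vblock (hblock (transpose L12) (hblock (- \<rho> *\<^sub>R mat 1) 0))
                (hblock (transpose X12) (hblock 0              (- mat 1)))))"

end

theory Submission
  imports Defs
begin

text \<open>
  Lyapunov argument with \<open>W = e \<bullet> P e\<close>.  Evaluating the matrix inequality at the vector
  \<open>(e, - w, \<delta>g / \<surd>\<alpha>, \<surd>\<alpha> J C\<^sub>a e)\<close> and using the Lipschitz bound
  \<open>\<parallel>\<delta>g\<parallel> \<le> \<alpha> \<parallel>(V\<^sub>a - J C\<^sub>a) e\<parallel>\<close> gives the dissipation inequality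
  \<open>W' + \<parallel>Cb e\<parallel>\<^sup>2 / 2 \<le> \<rho> \<parallel>w\<parallel>\<^sup>2\<close>, which is integrated from \<open>W 0 = 0\<close> using \<open>W T \<ge> 0\<close>.
  As \<open>e\<close> is only an indefinite integral, the product rule for \<open>W\<close> is proved in integrated
  form, by comparing increments over short intervals.
\<close>

section \<open>Product rule for solutions in the integral sense\<close>

text \<open>Cut the interval into pieces shorter than \<open>\<delta>\<close> and add up: the
  triangle inequality handles the left side, and the right side telescopes.\<close>

lemma increment_bound_local_to_global:
  fixes \<phi> :: "real \<Rightarrow> 'a::real_normed_vector" and G :: "real \<Rightarrow> real"
  assumes "0 < \<delta>" and "a \<le> b"
    and loc: "\<And>x y. \<lbrakk>a \<le> x; x \<le> y; y \<le> b; y - x < \<delta>\<rbrakk> \<Longrightarrow> norm (\<phi> y - \<phi> x) \<le> G y - G x"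
  shows "norm (\<phi> b - \<phi> a) \<le> G b - G a"
proof -
  have step: "norm (\<phi> y - \<phi> x) \<le> G y - G x"
    if "a \<le> x" "x \<le> y" "y \<le> b" "y - x < real (Suc n) * \<delta>" for n x y
    using that
  proof (induction n arbitrary: y)
    case 0
    then show ?case using loc by simp
  next
    case (Suc n)
    \<comment> \<open>This split point leaves a last piece of length
      \<open>(y - x) / (n + 2) < \<delta>\<close> and a first piece shorter than
      \<open>(n + 1) * \<delta>\<close>, which the induction hypothesis covers.\<close>
    define z where "z = x + (y - x) * (real (Suc n) / real (Suc (Suc n)))"
    have q: "0 \<le> real (Suc n) / real (Suc (Suc n))" "real (Suc n) / real (Suc (Suc n)) \<le> 1"
      by auto
    have xz: "x \<le> z" using q Suc.prems by (simp add: z_def)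
    have zy: "z \<le> y"
      using mult_left_mono [OF q(2), of "y - x"] Suc.prems by (simp add: z_def)
    have "(y - x) / real (Suc (Suc n)) < \<delta>"
      using Suc.prems(4) by (simp add: divide_less_eq mult.commute)
    moreover have "y - z = (y - x) / real (Suc (Suc n))"
      by (simp add: z_def field_simps)
    moreover have "z - x = real (Suc n) * ((y - x) / real (Suc (Suc n)))"
      by (simp add: z_def)
    ultimately have "y - z < \<delta>" "z - x < real (Suc n) * \<delta>"
      using mult_strict_left_mono [of "(y - x) / real (Suc (Suc n))" \<delta> "real (Suc n)"] by auto
    then have "norm (\<phi> z - \<phi> x) \<le> G z - G x" "norm (\<phi> y - \<phi> z) \<le> G y - G z"
      using Suc.IH [of z] loc [of z y] Suc.prems xz zy by auto
    then show ?case
      using norm_triangle_ineq [of "\<phi> y - \<phi> z" "\<phi> z - \<phi> x"] by simp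
  qed
  obtain n :: nat where "(b - a) / \<delta> < real n"
    using reals_Archimedean2 by blast
  then have "b - a < real (Suc n) * \<delta>"
    using assms(1) by (simp add: divide_less_eq distrib_right)
  then show ?thesis using step assms(2) by blast
qed

lemma solves_on_integrable_on: "solves_on T h x \<Longrightarrow> 0 \<le> T \<Longrightarrow> h integrable_on {0..T}"
  unfolding solves_on_def integrable_on_def by (meson atLeastAtMost_iff order_refl)

lemma solves_on_continuous_on:
  assumes "solves_on T h x"
  shows "continuous_on {0..T} x"
proof (cases "0 \<le> T")
  case True
  then have "h integrable_on {0..T}"
    by (rule solves_on_integrable_on [OF assms])
  then have "continuous_on {0..T} (\<lambda>t. x 0 + integral {0..t} h)"
    by (intro continuous_intros indefinite_integral_continuous_1)
  moreover have "x 0 + integral {0..t} h = x t" if "t \<in> {0..T}" for t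
    using assms that integral_unique [of h "x t - x 0" "{0..t}"] by (simp add: solves_on_def)
  ultimately show ?thesis
    by (rule continuous_on_eq)
qed simp

lemma solves_on_increment:
  assumes "solves_on T h x" and "0 \<le> s" "s \<le> t" "t \<le> T"
  shows "(h has_integral (x t - x s)) {s..t}"
proof -
  have s: "(h has_integral (x s - x 0)) {0..s}" and t: "(h has_integral (x t - x 0)) {0..t}"
    using assms by (auto simp: solves_on_def)
  then have "h integrable_on {s..t}"
    using assms integrable_on_subinterval [of h "{0..t}" s t] by (auto simp: integrable_on_def)
  then obtain i where i: "(h has_integral i) {s..t}" by blast
  have "(h has_integral (x s - x 0 + i)) {0..t}"
    using has_integral_combine [OF _ _ s i] assms by auto
  then have "i = x t - x s"
    using has_integral_unique [OF t] by (simp add: algebra_simps)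
  then show ?thesis using i by simp
qed

text \<open>\<open>F\<close> and \<open>H\<close> need not be differentiable at every point. Over a
  short interval the increment of the product is exactly an integral with one factor frozen in each
  summand; unfreezing costs at most \<open>\<epsilon> * K\<close> times the integral of
  \<open>norm (F' t) + norm (H' t)\<close>. These errors add up over \<open>{0..T}\<close> and
  vanish as \<epsilon> tends to 0.\<close>

lemma has_integral_bounded_bilinear_solves_on:
  fixes F F' :: "real \<Rightarrow> 'a::euclidean_space" and H H' :: "real \<Rightarrow> 'b::euclidean_space"
    and pr :: "'a \<Rightarrow> 'b \<Rightarrow> 'c::euclidean_space"
  assumes bil: "bounded_bilinear pr" and T: "0 \<le> T"
    and F: "solves_on T F' F" "F' absolutely_integrable_on {0..T}"
    and H: "solves_on T H' H" "H' absolutely_integrable_on {0..T}"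
  shows "((\<lambda>t. pr (F' t) (H t) + pr (F t) (H' t)) has_integral
           (pr (F T) (H T) - pr (F 0) (H 0))) {0..T}"
proof -
  interpret bounded_bilinear pr by (rule bil)
  have bl: "bilinear pr" "bilinear (\<lambda>x y. pr y x)"
    using bil by (simp_all add: bilinear_conv_bounded_bilinear bounded_bilinear.flip)
  obtain K where K: "0 < K" "\<And>x y. norm (pr x y) \<le> norm x * norm y * K"
    using pos_bounded by blast
  have cF: "continuous_on {0..T} F" and cH: "continuous_on {0..T} H"
    using F H solves_on_continuous_on by blast+
  have meas: "F \<in> borel_measurable (lebesgue_on {0..T})" "H \<in> borel_measurable (lebesgue_on {0..T})"
    using cF cH by (auto intro: continuous_imp_measurable_on_sets_lebesgue)
  have bdd: "bounded (F ` {0..T})" "bounded (H ` {0..T})"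
    using cF cH by (auto intro!: compact_imp_bounded compact_continuous_image)
  define q where "q t = pr (F' t) (H t) + pr (F t) (H' t)" for t
  \<comment> \<open>Each summand pairs a bounded measurable factor with an absolutely integrable
    one. The flipped product serves the first summand, whose integrable factor \<open>F'\<close>
    comes first.\<close>
  have "q absolutely_integrable_on {0..T}"
    unfolding q_def
    using absolutely_integrable_bounded_measurable_product [OF bl(2) meas(2) _ bdd(2) F(2)]
      absolutely_integrable_bounded_measurable_product [OF bl(1) meas(1) _ bdd(1) H(2)]
    by (auto intro!: set_integral_add)
  then have q: "q integrable_on {0..T}"
    by (rule set_lebesgue_integral_eq_integral)
  define m where "m t = norm (F' t) + norm (H' t)" for t
  have m: "m integrable_on {0..T}"
    unfolding m_def using F(2) H(2)
    by (intro integrable_add) (auto simp: absolutely_integrable_on_def)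
  \<comment> \<open>The defect of the product rule; the claim amounts to equal values at
    \<open>T\<close> and at \<open>0\<close>.\<close>
  define \<phi> where "\<phi> t = pr (F t) (H t) - integral {0..t} q" for t
  define G where "G t = integral {0..t} m" for t
  have incr: "integral {0..y} k - integral {0..x} k = integral {x..y} k"
    if "k integrable_on {0..T}" "0 \<le> x" "x \<le> y" "y \<le> T" for k :: "real \<Rightarrow> 'd::banach" and x y
  proof -
    have "k integrable_on {0..y}"
      using that integrable_on_subinterval by fastforce
    from Henstock_Kurzweil_Integration.integral_combine [OF that(2,3) this] show ?thesis by (simp add: algebra_simps)
  qed
  have small: "norm (\<phi> T - \<phi> 0) \<le> \<epsilon> * (K * G T)" if "0 < \<epsilon>" for \<epsilon>
  proof -
    obtain d1 where d1: "0 < d1" "\<And>x y. \<lbrakk>x \<in> {0..T}; y \<in> {0..T}; dist x y < d1\<rbrakk> \<Longrightarrow> dist (F x) (F y) < \<epsilon>"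
      using compact_uniformly_continuous [OF cF compact_Icc] \<open>0 < \<epsilon>\<close>
      unfolding uniformly_continuous_on_def by blast
    obtain d2 where d2: "0 < d2" "\<And>x y. \<lbrakk>x \<in> {0..T}; y \<in> {0..T}; dist x y < d2\<rbrakk> \<Longrightarrow> dist (H x) (H y) < \<epsilon>"
      using compact_uniformly_continuous [OF cH compact_Icc] \<open>0 < \<epsilon>\<close>
      unfolding uniformly_continuous_on_def by blast
    have "norm (\<phi> T - \<phi> 0) \<le> (\<epsilon> * K) * G T - (\<epsilon> * K) * G 0"
    proof (rule increment_bound_local_to_global [where \<delta> = "min d1 d2"])
      show "0 < min d1 d2" "0 \<le> T" using d1 d2 T by auto
      fix x y assume xy: "0 \<le> x" "x \<le> y" "y \<le> T" "y - x < min d1 d2"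
      have sub: "{x..y} \<subseteq> {0..T}" using xy by simp
      have qxy: "q integrable_on {x..y}" and mxy: "m integrable_on {x..y}"
        using integrable_on_subinterval [OF q sub] integrable_on_subinterval [OF m sub] .
      \<comment> \<open>With \<open>H\<close> frozen at the right end and \<open>F\<close> at the
        left end, the two increments sum to that of \<open>pr (F t) (H t)\<close> with no
        second-order term left over.\<close>
      have 1: "((\<lambda>t. pr (F' t) (H y)) has_integral pr (F y - F x) (H y)) {x..y}"
        using has_integral_linear [OF solves_on_increment [OF F(1) xy(1-3)] bounded_linear_left, of "H y"]
        by (simp add: o_def)
      have 2: "((\<lambda>t. pr (F x) (H' t)) has_integral pr (F x) (H y - H x)) {x..y}"
        using has_integral_linear [OF solves_on_increment [OF H(1) xy(1-3)] bounded_linear_right, of "F x"]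
        by (simp add: o_def)
      have "((\<lambda>t. pr (F' t) (H y) + pr (F x) (H' t)) has_integral
          (pr (F y) (H y) - pr (F x) (H x))) {x..y}"
        using has_integral_add [OF 1 2] by (simp add: diff_left diff_right)
      from has_integral_diff [OF this integrable_integral [OF qxy]]
      have D: "((\<lambda>t. pr (F' t) (H y - H t) + pr (F x - F t) (H' t)) has_integral (\<phi> y - \<phi> x)) {x..y}"
        using incr [OF q xy(1-3)]
        by (simp add: q_def \<phi>_def diff_left diff_right algebra_simps)
      have "norm (\<phi> y - \<phi> x) \<le> integral {x..y} (\<lambda>t. (\<epsilon> * K) * m t)"
        unfolding integral_unique [OF D, symmetric]
      proof (rule integral_norm_bound_integral)
        show "(\<lambda>t. pr (F' t) (H y - H t) + pr (F x - F t) (H' t)) integrable_on {x..y}"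
          using D by blast
        show "(\<lambda>t. (\<epsilon> * K) * m t) integrable_on {x..y}"
          using mxy by (rule integrable_on_mult_right)
        fix t assume t: "t \<in> {x..y}"
        have "norm (H y - H t) \<le> \<epsilon>" "norm (F x - F t) \<le> \<epsilon>"
          using d1(2) [of x t] d2(2) [of y t] t xy by (auto simp: dist_norm)
        then have "norm (F' t) * norm (H y - H t) * K \<le> norm (F' t) * \<epsilon> * K"
          "norm (F x - F t) * norm (H' t) * K \<le> \<epsilon> * norm (H' t) * K"
          using K(1) by (auto intro!: mult_right_mono mult_left_mono)
        then have "norm (pr (F' t) (H y - H t)) \<le> norm (F' t) * \<epsilon> * K"
          "norm (pr (F x - F t) (H' t)) \<le> \<epsilon> * norm (H' t) * K"
          using K(2) order_trans by blast+
        then show "norm (pr (F' t) (H y - H t) + pr (F x - F t) (H' t)) \<le> (\<epsilon> * K) * m t"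
          using norm_triangle_ineq [of "pr (F' t) (H y - H t)" "pr (F x - F t) (H' t)"]
          by (simp add: m_def algebra_simps)
      qed
      also have "\<dots> = (\<epsilon> * K) * G y - (\<epsilon> * K) * G x"
        using incr [OF m xy(1-3)] by (simp add: G_def flip: right_diff_distrib)
      finally show "norm (\<phi> y - \<phi> x) \<le> (\<epsilon> * K) * G y - (\<epsilon> * K) * G x" .
    qed
    then show ?thesis by (simp add: G_def mult.assoc)
  qed
  have "norm (\<phi> T - \<phi> 0) \<le> 0"
  proof (rule field_le_epsilon)
    fix d :: real assume "0 < d"
    have KG: "0 \<le> K * G T"
      unfolding G_def using K(1)
      by (intro mult_nonneg_nonneg integral_nonneg m) (auto simp: m_def)
    \<comment> \<open>The \<open>+ 1\<close> keeps the denominator positive when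
      \<open>K * G T\<close> is zero.\<close>
    have "norm (\<phi> T - \<phi> 0) \<le> d / (K * G T + 1) * (K * G T)"
      using KG \<open>0 < d\<close> by (intro small) auto
    also have "\<dots> \<le> 0 + d"
      using KG \<open>0 < d\<close> by (simp add: divide_le_eq)
    finally show "norm (\<phi> T - \<phi> 0) \<le> 0 + d" .
  qed
  then have "integral {0..T} q = pr (F T) (H T) - pr (F 0) (H 0)"
    by (simp add: \<phi>_def algebra_simps)
  then show ?thesis
    using integrable_integral [OF q] by (simp add: q_def [abs_def])
qed

section \<open>Block vectors and the quadratic form of the matrix inequality\<close>

text \<open>The analogue of \<open>vblock\<close> for plain vectors; on test vectors of this shape a
  block form splits into inner products of the parts.\<close>

definition vjoin :: "real^'a \<Rightarrow> real^'b \<Rightarrow> real^('a + 'b)" where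
  "vjoin x y = (\<chi> i. case i of Inl a \<Rightarrow> x $ a | Inr b \<Rightarrow> y $ b)"

lemma sum_UNIV_Plus:
  fixes f :: "'a::finite + 'b::finite \<Rightarrow> 'c::comm_monoid_add"
  shows "sum f UNIV = (\<Sum>i\<in>UNIV. f (Inl i)) + (\<Sum>i\<in>UNIV. f (Inr i))"
  by (simp add: sum.Plus flip: UNIV_Plus_UNIV)

lemma inner_vjoin: "vjoin x y \<bullet> vjoin x' y' = x \<bullet> x' + y \<bullet> y'"
  by (simp add: inner_vec_def vjoin_def sum_UNIV_Plus)

lemma hblock_mult_vjoin: "hblock X Y *v vjoin x y = X *v x + Y *v y"
  by (simp add: vec_eq_iff matrix_vector_mult_def hblock_def vjoin_def sum_UNIV_Plus)

lemma vblock_mult: "vblock X Y *v z = vjoin (X *v z) (Y *v z)"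
  by (auto simp: vec_eq_iff matrix_vector_mult_def vblock_def vjoin_def split: sum.split)

lemma inner_transpose_mult: "x \<bullet> (transpose A *v y) = (A *v x) \<bullet> y" for A :: "real^'a^'b"
  by (metis dot_lmul_matrix inner_commute transpose_matrix_vector)

lemma matrix_vector_mult_minus_right: "A *v (- x) = - (A *v x)" for A :: "real^'a^'b"
  using matrix_vector_mult_diff_distrib [of A 0 x] by simp

text \<open>A positive definite matrix has trivial kernel and is therefore invertible, which gives
  the choice in \<open>matrix_inv\<close> a witness.\<close>

lemma pos_def_mult_matrix_inv:
  assumes "pos_def P"
  shows "P ** matrix_inv P = mat 1"
proof -
  have "\<forall>x. P *v x = 0 \<longrightarrow> x = 0"
    using assms by (metis inner_zero_right less_irrefl pos_def_def)
  then have "invertible P"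
    by (simp add: invertible_left_inverse matrix_left_invertible_ker)
  then have "\<exists>P'. P ** P' = mat 1 \<and> P' ** P = mat 1"
    by (simp add: invertible_def)
  then show ?thesis
    unfolding matrix_inv_def by (rule someI2_ex) simp
qed

lemma pos_def_symmetric: "pos_def P \<Longrightarrow> x \<bullet> (P *v y) = (P *v x) \<bullet> y"
  by (metis inner_transpose_mult pos_def_def)

text \<open>Off-diagonal blocks occur together with their transposes and count twice. Inside
  \<open>lmi_X\<close> each term other than \<open>transpose V\<^sub>a ** V\<^sub>a\<close> likewise
  pairs with its transpose.\<close>

lemma lmi_matrix_quadratic_form:
  fixes e :: "real^'z" and w :: "real^'f" and a :: "real^'g" and b :: "real^'v"
    and S\<^sub>a :: "real^'g^'z" and V\<^sub>a :: "real^'z^'v" and C\<^sub>a :: "real^'z^'m"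
    and D\<^sub>a :: "real^'f^'z" and Cb :: "real^'z^'p" and P :: "real^'z^'z"
  assumes P: "pos_def P"
  defines "\<xi> \<equiv> vjoin e (vjoin w (vjoin a b))"
  shows "\<xi> \<bullet> (lmi_matrix \<alpha> A\<^sub>a S\<^sub>a V\<^sub>a C\<^sub>a D\<^sub>a Cb P R Q J \<rho> *v \<xi>) =
    2 * (e \<bullet> ((P + R ** C\<^sub>a) *v (A\<^sub>a *v e) - Q *v (C\<^sub>a *v e)))
    + \<alpha> * ((norm (V\<^sub>a *v e))\<^sup>2 - 2 * ((V\<^sub>a *v e) \<bullet> (J *v (C\<^sub>a *v e))))
    + (norm (Cb *v e))\<^sup>2 / 2
    + 2 * (e \<bullet> ((P + R ** C\<^sub>a) *v (D\<^sub>a *v w)))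
    + 2 * sqrt \<alpha> * (e \<bullet> ((P + R ** C\<^sub>a) *v (S\<^sub>a *v a)))
    + 2 * sqrt \<alpha> * ((J *v (C\<^sub>a *v e)) \<bullet> b)
    - \<rho> * (norm w)\<^sup>2 - (norm a)\<^sup>2 - (norm b)\<^sup>2"
proof -
  have left: "(transpose X *v y) \<bullet> x = y \<bullet> (X *v x)" for X :: "real^'i^'j" and x y
    by (metis inner_commute inner_transpose_mult)
  have neg: "(- X) *v y = - (X *v y)" for X :: "real^'i^'j" and y
    using matrix_vector_mult_diff_rdistrib [of 0 X y] by simp
  \<comment> \<open>Each equation fixes one order for an inner product, so that transposed pairs
    become equal terms. The first is where the symmetry of \<open>P\<close> enters.\<close>
  have sym: "(A\<^sub>a *v e) \<bullet> (P *v e) = e \<bullet> (P *v (A\<^sub>a *v e))"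
    "(P *v x) \<bullet> e = e \<bullet> (P *v x)" "(R *v y) \<bullet> e = e \<bullet> (R *v y)" "(Q *v y) \<bullet> e = e \<bullet> (Q *v y)"
    "b \<bullet> (J *v y) = (J *v y) \<bullet> b" "(J *v y) \<bullet> (V\<^sub>a *v e) = (V\<^sub>a *v e) \<bullet> (J *v y)" for x y
    using pos_def_symmetric [OF P, of e "A\<^sub>a *v e"] by (simp_all add: inner_commute)
  show ?thesis
    unfolding \<xi>_def lmi_matrix_def Let_def lmi_X_def lmi_X12_def
    by (simp add: vblock_mult hblock_mult_vjoin inner_vjoin inner_add_right inner_diff_right
        inner_add_left inner_diff_left left neg sym
        matrix_vector_mult_add_rdistrib matrix_vector_mult_diff_rdistrib
        inner_transpose_mult matrix_vector_mul_assoc [symmetric]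
        scaleR_matrix_vector_assoc [symmetric] power2_norm_eq_inner del: transpose_matrix_vector)
      (simp add: algebra_simps)
qed

section \<open>Pointwise dissipation inequality\<close>

lemma lmi_dissipation:
  fixes e :: "real^'z" and w :: "real^'f" and d :: "real^'g"
    and S\<^sub>a :: "real^'g^'z" and V\<^sub>a :: "real^'z^'v" and C\<^sub>a :: "real^'z^'m"
    and D\<^sub>a :: "real^'f^'z" and Cb :: "real^'z^'p" and P :: "real^'z^'z"
  assumes \<alpha>: "\<alpha> > 0" and P: "pos_def P"
    and lmi: "neg_semidef (lmi_matrix \<alpha> A\<^sub>a S\<^sub>a V\<^sub>a C\<^sub>a D\<^sub>a Cb P R Q J \<rho>)"
    and d: "norm d \<le> \<alpha> * norm (V\<^sub>a *v e - J *v (C\<^sub>a *v e))"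
  defines "E \<equiv> matrix_inv P ** R" and "K \<equiv> matrix_inv P ** Q"
  shows "2 * (e \<bullet> (P *v (obs_N A\<^sub>a C\<^sub>a E K *v e + (obs_M C\<^sub>a E ** S\<^sub>a) *v d - (obs_M C\<^sub>a E ** D\<^sub>a) *v w)))
    + (norm (Cb *v e))\<^sup>2 / 2 \<le> \<rho> * (norm w)\<^sup>2"
proof -
  define v where "v = V\<^sub>a *v e"
  define j where "j = J *v (C\<^sub>a *v e)"
  define L where "L = P + R ** C\<^sub>a"
  have cancel: "P *v (matrix_inv P *v x) = x" for x
    by (simp add: matrix_vector_mul_assoc pos_def_mult_matrix_inv [OF P])
  \<comment> \<open>Since \<open>P ** E = R\<close>, multiplication by \<open>P\<close> removes the
    inverse; this is how \<open>R\<close> and \<open>Q\<close> replace the gains \<open>E\<close>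
    and \<open>K\<close>.\<close>
  have M: "P *v (obs_M C\<^sub>a E *v x) = L *v x" for x
    by (simp add: obs_M_def E_def L_def matrix_vector_mult_add_rdistrib matrix_vector_right_distrib
        matrix_vector_mul_assoc [symmetric] cancel)
  have rhs: "P *v (obs_N A\<^sub>a C\<^sub>a E K *v e + (obs_M C\<^sub>a E ** S\<^sub>a) *v d - (obs_M C\<^sub>a E ** D\<^sub>a) *v w)
      = L *v (A\<^sub>a *v e) - Q *v (C\<^sub>a *v e) + L *v (S\<^sub>a *v d) - L *v (D\<^sub>a *v w)"
    by (simp add: obs_N_def K_def matrix_vector_mult_diff_rdistrib matrix_vector_right_distrib
        matrix_vector_mult_diff_distrib matrix_vector_mul_assoc [symmetric] cancel M)
  have "sqrt \<alpha> \<noteq> 0" "(sqrt \<alpha>)\<^sup>2 = \<alpha>" using \<alpha> by auto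
  then have scaled:
    "2 * sqrt \<alpha> * (e \<bullet> (L *v (S\<^sub>a *v ((1 / sqrt \<alpha>) *\<^sub>R d)))) = 2 * (e \<bullet> (L *v (S\<^sub>a *v d)))"
    "2 * sqrt \<alpha> * (j \<bullet> (sqrt \<alpha> *\<^sub>R j)) = 2 * \<alpha> * (j \<bullet> j)"
    "(norm ((1 / sqrt \<alpha>) *\<^sub>R d))\<^sup>2 = (norm d)\<^sup>2 / \<alpha>"
    "(norm (sqrt \<alpha> *\<^sub>R j))\<^sup>2 = \<alpha> * (norm j)\<^sup>2"
    by (simp_all add: matrix_vector_mult_scaleR power_mult_distrib power_divide flip: power2_eq_square)
  \<comment> \<open>\<open>- w\<close> matches the sign of the input in the error equation,
    \<open>1 / sqrt \<alpha>\<close> undoes the scaling in \<open>lmi_X12\<close>, and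
    \<open>sqrt \<alpha> *\<^sub>R j\<close> maximises
    \<open>2 * sqrt \<alpha> * (j \<bullet> b) - (norm b)\<^sup>2\<close> over
    \<open>b\<close>.\<close>
  have "vjoin e (vjoin (- w) (vjoin ((1 / sqrt \<alpha>) *\<^sub>R d) (sqrt \<alpha> *\<^sub>R j))) \<bullet>
      (lmi_matrix \<alpha> A\<^sub>a S\<^sub>a V\<^sub>a C\<^sub>a D\<^sub>a Cb P R Q J \<rho> *v
       vjoin e (vjoin (- w) (vjoin ((1 / sqrt \<alpha>) *\<^sub>R d) (sqrt \<alpha> *\<^sub>R j)))) \<le> 0"
    using lmi by (simp add: neg_semidef_def)
  then have "2 * (e \<bullet> (L *v (A\<^sub>a *v e) - Q *v (C\<^sub>a *v e))) + \<alpha> * ((norm v)\<^sup>2 - 2 * (v \<bullet> j))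
      + (norm (Cb *v e))\<^sup>2 / 2 - 2 * (e \<bullet> (L *v (D\<^sub>a *v w))) + 2 * (e \<bullet> (L *v (S\<^sub>a *v d)))
      + 2 * \<alpha> * (j \<bullet> j) - \<rho> * (norm w)\<^sup>2 - (norm d)\<^sup>2 / \<alpha> - \<alpha> * (norm j)\<^sup>2 \<le> 0"
    unfolding lmi_matrix_quadratic_form [OF P] v_def [symmetric] j_def [symmetric] L_def [symmetric]
      scaled
    by (simp add: matrix_vector_mult_minus_right)
  moreover have "(norm d)\<^sup>2 / \<alpha> \<le> \<alpha> * (norm (v - j))\<^sup>2"
  proof -
    have "(norm d)\<^sup>2 \<le> (\<alpha> * norm (v - j))\<^sup>2"
      using d by (intro power_mono) (auto simp: v_def j_def)
    then show ?thesis using \<alpha> by (simp add: divide_le_eq power_mult_distrib power2_eq_square mult_ac)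
  qed
  moreover have "(norm (v - j))\<^sup>2 = (norm v)\<^sup>2 - 2 * (v \<bullet> j) + (norm j)\<^sup>2"
    by (simp add: power2_norm_eq_inner inner_diff_left inner_diff_right inner_commute)
  ultimately show ?thesis
    unfolding rhs by (simp add: inner_add_right inner_diff_right power2_norm_eq_inner algebra_simps)
qed

section \<open>Bounds and integrability for the error equation\<close>

text \<open>The plant state cancels in the output error, which is
  \<open>- (C\<^sub>a *v e t)\<close>. Both arguments of \<open>g\<close> lie in the set of the
  Lipschitz condition, the second one with \<open>\<eta> = 0\<close>.\<close>

lemma norm_delta_g_le:
  assumes "uniformly_lipschitz \<alpha> V\<^sub>a J g"
  shows "norm (delta_g V\<^sub>a C\<^sub>a g J u x\<^sub>a e t) \<le> \<alpha> * norm (V\<^sub>a *v e t - J *v (C\<^sub>a *v e t))"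
proof -
  let ?v = "V\<^sub>a *v (x\<^sub>a t + e t) + J *v (C\<^sub>a *v x\<^sub>a t - C\<^sub>a *v (x\<^sub>a t + e t))"
  have "?v \<in> {V\<^sub>a *v x + J *v \<eta> | x \<eta>. True}" by blast
  moreover have "V\<^sub>a *v x\<^sub>a t + J *v 0 \<in> {V\<^sub>a *v x + J *v \<eta> | x \<eta>. True}" by blast
  ultimately have "norm (g ?v (u t) - g (V\<^sub>a *v x\<^sub>a t) (u t)) \<le> \<alpha> * norm (?v - V\<^sub>a *v x\<^sub>a t)"
    using assms by (auto simp: uniformly_lipschitz_def lipschitz_on_def dist_norm)
  moreover have "?v - V\<^sub>a *v x\<^sub>a t = V\<^sub>a *v e t - J *v (C\<^sub>a *v e t)"
    by (simp add: matrix_vector_right_distrib matrix_vector_mult_minus_right)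
  ultimately show ?thesis by (simp add: delta_g_def Let_def)
qed

text \<open>On a bounded interval constants are integrable, and \<open>s \<le> 1 + s\<^sup>2\<close>
  dominates the norm.\<close>

lemma L2_on_norm_integrable:
  assumes "L2_on T w"
  shows "(\<lambda>t. norm (w t)) integrable_on {0..T}"
proof -
  have "(\<lambda>t. 1 + (norm (w t))\<^sup>2) integrable_on {0..T}"
    using assms by (intro integrable_add integrable_on_lebesgue_on) (auto simp: L2_on_def)
  moreover have "norm (w t) \<le> 1 + (norm (w t))\<^sup>2" for t
    using zero_le_power2 [of "norm (w t) - 1"] norm_ge_zero [of "w t"]
    unfolding power2_diff power_one by linarith
  ultimately have "w absolutely_integrable_on {0..T}"
    using assms
    by (intro measurable_bounded_by_integrable_imp_absolutely_integrable) (auto simp: L2_on_def)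
  then show ?thesis by (simp add: absolutely_integrable_on_def)
qed

lemma continuous_on_matrix_vector_mult [continuous_intros]:
  fixes A :: "real^'a^'b"
  shows "continuous_on S f \<Longrightarrow> continuous_on S (\<lambda>t. A *v f t)"
  by (rule bounded_linear.continuous_on [OF matrix_vector_mul_bounded_linear])

text \<open>
  The known input \<open>u\<close> need not be measurable; measurability of the right-hand side comes from
  its Henstock--Kurzweil integrability.
\<close>

lemma error_rhs_absolutely_integrable:
  assumes lip: "uniformly_lipschitz \<alpha> V\<^sub>a J g" and T: "0 \<le> T" and w: "L2_on T w"
    and e: "solves_on T (error_rhs A\<^sub>a S\<^sub>a V\<^sub>a C\<^sub>a D\<^sub>a g E K J u w x\<^sub>a e) e"
  shows "error_rhs A\<^sub>a S\<^sub>a V\<^sub>a C\<^sub>a D\<^sub>a g E K J u w x\<^sub>a e absolutely_integrable_on {0..T}"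
    (is "?h absolutely_integrable_on _")
proof (rule measurable_bounded_by_integrable_imp_absolutely_integrable)
  let ?N = "obs_N A\<^sub>a C\<^sub>a E K" and ?S = "obs_M C\<^sub>a E ** S\<^sub>a" and ?D = "obs_M C\<^sub>a E ** D\<^sub>a"
  have "?h integrable_on {0..T}"
    by (rule solves_on_integrable_on [OF e T])
  then show "?h \<in> borel_measurable (lebesgue_on {0..T})"
    by (rule integrable_imp_measurable)
  \<comment> \<open>The first two summands are continuous because \<open>e\<close> is; the third is
    integrable because \<open>w\<close> is square integrable on a bounded interval.\<close>
  let ?\<beta> = "\<lambda>t. onorm ((*v) ?N) * norm (e t)
    + onorm ((*v) ?S) * (\<alpha> * norm (V\<^sub>a *v e t - J *v (C\<^sub>a *v e t))) + onorm ((*v) ?D) * norm (w t)"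
  show "?\<beta> integrable_on {0..T}"
    using solves_on_continuous_on [OF e]
    by (intro integrable_add [OF integrable_continuous_real
          integrable_on_mult_right [OF L2_on_norm_integrable [OF w]]] continuous_intros)
  fix t
  have mult: "norm (X *v x) \<le> onorm ((*v) X) * norm x" for X :: "real^'i^'j" and x
    by (rule onorm [OF matrix_vector_mul_bounded_linear])
  have "norm (?S *v delta_g V\<^sub>a C\<^sub>a g J u x\<^sub>a e t)
      \<le> onorm ((*v) ?S) * (\<alpha> * norm (V\<^sub>a *v e t - J *v (C\<^sub>a *v e t)))"
    by (rule order_trans [OF mult mult_left_mono [OF norm_delta_g_le [OF lip]]])
      (rule onorm_pos_le [OF matrix_vector_mul_bounded_linear])
  then show "norm (?h t) \<le> ?\<beta> t"
    unfolding error_rhs_def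
    by (intro norm_triangle_le_diff norm_triangle_le add_mono mult)
qed simp

section \<open>Gain bound, first for general and then for augmented matrices\<close>

text \<open>The integrated dissipation inequality puts half the output energy below
  \<open>\<rho>\<close> times the input energy; doubling gives the factor \<open>2 * \<rho>\<close>,
  the square of the gain.\<close>

lemma L2_gain_le_of_lmi:
  fixes S\<^sub>a :: "real^'g^'z" and V\<^sub>a :: "real^'z^'v" and C\<^sub>a :: "real^'z^'m"
    and D\<^sub>a :: "real^'f^'z" and Cb :: "real^'z^'p" and P :: "real^'z^'z"
  assumes \<alpha>: "\<alpha> > 0" and lip: "uniformly_lipschitz \<alpha> V\<^sub>a J g"
    and P: "pos_def P" and \<rho>: "\<rho> \<ge> 0"
    and lmi: "neg_semidef (lmi_matrix \<alpha> A\<^sub>a S\<^sub>a V\<^sub>a C\<^sub>a D\<^sub>a Cb P R Q J \<rho>)"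
  shows "L2_gain_le (sqrt (2 * \<rho>))
    (error_dynamics A\<^sub>a B\<^sub>a S\<^sub>a V\<^sub>a C\<^sub>a D\<^sub>a Cb g (matrix_inv P ** R) (matrix_inv P ** Q) J)"
  unfolding L2_gain_le_def
proof (intro allI impI, elim conjE)
  fix T :: real and w :: "real \<Rightarrow> real^'f" and p :: "real \<Rightarrow> real^'p"
  let ?E = "matrix_inv P ** R" and ?K = "matrix_inv P ** Q"
  assume T: "0 \<le> T" and w: "L2_on T w"
    and "error_dynamics A\<^sub>a B\<^sub>a S\<^sub>a V\<^sub>a C\<^sub>a D\<^sub>a Cb g ?E ?K J T w p"
  then obtain u x\<^sub>a e where
    e: "solves_on T (error_rhs A\<^sub>a S\<^sub>a V\<^sub>a C\<^sub>a D\<^sub>a g ?E ?K J u w x\<^sub>a e) e" "e 0 = 0"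
    and p: "p = (\<lambda>t. Cb *v e t)"
    unfolding error_dynamics_def by blast
  define h where "h = error_rhs A\<^sub>a S\<^sub>a V\<^sub>a C\<^sub>a D\<^sub>a g ?E ?K J u w x\<^sub>a e"
  have sol: "solves_on T h e" using e(1) by (simp add: h_def)
  have abs: "h absolutely_integrable_on {0..T}"
    unfolding h_def by (rule error_rhs_absolutely_integrable [OF lip T w e(1)])
  \<comment> \<open>The product rule is to be applied to \<open>e\<close> and \<open>P *v e\<close>
    under the inner product, so the second factor must be an integral solution too.\<close>
  have sol': "solves_on T (\<lambda>t. P *v h t) (\<lambda>t. P *v e t)"
    unfolding solves_on_def
  proof
    fix t assume "t \<in> {0..T}"
    then have "(h has_integral (e t - e 0)) {0..t}" using sol by (simp add: solves_on_def)
    from has_integral_linear [OF this matrix_vector_mul_bounded_linear [of P]]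
    show "((\<lambda>t. P *v h t) has_integral (P *v e t - P *v e 0)) {0..t}"
      by (simp add: o_def matrix_vector_mult_diff_distrib)
  qed
  have abs': "(\<lambda>t. P *v h t) absolutely_integrable_on {0..T}"
    using absolutely_integrable_linear [OF abs matrix_vector_mul_bounded_linear [of P]]
    by (simp add: o_def)
  have cp: "continuous_on {0..T} p"
    unfolding p using solves_on_continuous_on [OF sol] by (intro continuous_intros)
  have ip: "integrable (lebesgue_on {0..T}) (\<lambda>t. (norm (p t))\<^sup>2)"
    using cp by (intro continuous_imp_integrable_real continuous_intros)
  have iw: "integrable (lebesgue_on {0..T}) (\<lambda>t. (norm (w t))\<^sup>2)"
    using w by (simp add: L2_on_def)
  have "((\<lambda>t. h t \<bullet> (P *v e t) + e t \<bullet> (P *v h t)) has_integral e T \<bullet> (P *v e T)) {0..T}"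
    using has_integral_bounded_bilinear_solves_on [OF bounded_bilinear_inner T sol abs sol' abs'] e(2)
    by simp
  \<comment> \<open>Symmetry of \<open>P\<close> merges the two summands of the product rule into
    one.\<close>
  moreover have "h t \<bullet> (P *v e t) = e t \<bullet> (P *v h t)" for t
    by (simp add: pos_def_symmetric [OF P, of "e t"] inner_commute)
  ultimately have W: "((\<lambda>t. 2 * (e t \<bullet> (P *v h t))) has_integral e T \<bullet> (P *v e T)) {0..T}"
    by simp
  \<comment> \<open>The gain is defined by Lebesgue integrals, while \<open>W\<close> is a
    Henstock-Kurzweil integral; both energies are transferred to the latter for comparison.\<close>
  have hp: "((\<lambda>t. (norm (p t))\<^sup>2) has_integral (\<integral>t. (norm (p t))\<^sup>2 \<partial>lebesgue_on {0..T})) {0..T}"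
    and hw: "((\<lambda>t. (norm (w t))\<^sup>2) has_integral (\<integral>t. (norm (w t))\<^sup>2 \<partial>lebesgue_on {0..T})) {0..T}"
    using ip iw by (auto intro: has_integral_integral_lebesgue_on)
  have "e T \<bullet> (P *v e T) + (\<integral>t. (norm (p t))\<^sup>2 \<partial>lebesgue_on {0..T}) / 2
      \<le> \<rho> * (\<integral>t. (norm (w t))\<^sup>2 \<partial>lebesgue_on {0..T})"
  proof (rule has_integral_le [OF has_integral_add [OF W has_integral_divide [OF hp]]
          has_integral_mult_right [OF hw]])
    fix t
    show "2 * (e t \<bullet> (P *v h t)) + (norm (p t))\<^sup>2 / 2 \<le> \<rho> * (norm (w t))\<^sup>2"
      unfolding h_def p error_rhs_def
      by (rule lmi_dissipation [OF \<alpha> P lmi norm_delta_g_le [OF lip]])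
  qed
  moreover have "0 \<le> e T \<bullet> (P *v e T)"
    using P unfolding pos_def_def by (cases "e T = 0") (auto intro: less_imp_le)
  ultimately have "(\<integral>t. (norm (p t))\<^sup>2 \<partial>lebesgue_on {0..T})
      \<le> (sqrt (2 * \<rho>))\<^sup>2 * (\<integral>t. (norm (w t))\<^sup>2 \<partial>lebesgue_on {0..T})"
    using \<rho> by simp
  moreover have "L2_on T p"
    using cp ip by (auto simp: L2_on_def intro: continuous_imp_measurable_on_sets_lebesgue)
  ultimately show "L2_on T p \<and> (\<integral>t. (norm (p t))\<^sup>2 \<partial>lebesgue_on {0..T})
      \<le> (sqrt (2 * \<rho>))\<^sup>2 * (\<integral>t. (norm (w t))\<^sup>2 \<partial>lebesgue_on {0..T})"
    by blast
qed

text \<open>\<open>aug_V V\<close> sees only the first block of the augmented state, so the points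
  at which the bound is required already occur for \<open>V\<close>.\<close>

lemma uniformly_lipschitz_aug_V:
  fixes V :: "real^'n^'v" and J :: "real^'m^'v"
  assumes "uniformly_lipschitz \<alpha> V J g"
  shows "uniformly_lipschitz \<alpha>
    (aug_V V :: real^('n + 'r::{finite,linorder} \<times> 'f::finite)^'v) J g"
proof -
  have "(aug_V V :: real^('n + 'r \<times> 'f)^'v) *v x = V *v (\<chi> i. x $ Inl i)" for x
    by (simp add: vec_eq_iff matrix_vector_mult_def aug_V_def hblock_def sum_UNIV_Plus)
  then have "{(aug_V V :: real^('n + 'r \<times> 'f)^'v) *v x + J *v \<eta> | x \<eta>. True}
      \<subseteq> {V *v x + J *v \<eta> | x \<eta>. True}"
    by auto
  then show ?thesis
    using assms unfolding uniformly_lipschitz_def by (blast intro: lipschitz_on_subset)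
qed

theorem proposition2:
  fixes A :: "real^'n^'n" and B :: "real^'l^'n" and S :: "real^'g^'n" and V :: "real^'n^'v"
    and C :: "real^'n^'m" and F\<^sub>x :: "real^'f^'n" and F\<^sub>y :: "real^'f^'m"
    and g :: "real^'v \<Rightarrow> real^'l \<Rightarrow> real^'g" and \<alpha> \<rho> :: real
    and P :: "real^('n + 'r::{finite,linorder} \<times> 'f)^('n + 'r \<times> 'f)"
    and R Q :: "real^'m^('n + 'r \<times> 'f)" and J :: "real^'m^'v"
  defines "A\<^sub>a \<equiv> aug_A A F\<^sub>x :: real^('n + 'r \<times> 'f)^('n + 'r \<times> 'f)"
    and "B\<^sub>a \<equiv> aug_B B :: real^'l^('n + 'r \<times> 'f)"
    and "S\<^sub>a \<equiv> aug_B S :: real^'g^('n + 'r \<times> 'f)"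
    and "V\<^sub>a \<equiv> aug_V V :: real^('n + 'r \<times> 'f)^'v"
    and "C\<^sub>a \<equiv> aug_C C F\<^sub>y :: real^('n + 'r \<times> 'f)^'m"
    and "D\<^sub>a \<equiv> aug_D :: real^'f^('n + 'r \<times> 'f)"
    and "Cb \<equiv> fault_out :: real^('n + 'r \<times> 'f)^'f"
  assumes "\<alpha> > 0" and "uniformly_lipschitz \<alpha> V J g"
    and "pos_def P" and "\<rho> \<ge> 0"
    and "neg_semidef (lmi_matrix \<alpha> A\<^sub>a S\<^sub>a V\<^sub>a C\<^sub>a D\<^sub>a Cb P R Q J \<rho>)"
  shows "L2_gain_le (sqrt (2 * \<rho>))
    (error_dynamics A\<^sub>a B\<^sub>a S\<^sub>a V\<^sub>a C\<^sub>a D\<^sub>a Cb g (matrix_inv P ** R) (matrix_inv P ** Q) J)"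
proof -
  have "uniformly_lipschitz \<alpha> V\<^sub>a J g"
    unfolding assms(4) by (rule uniformly_lipschitz_aug_V [OF assms(9)])
  then show ?thesis
    using assms(8,10-12) by (intro L2_gain_le_of_lmi)
qed

end
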